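(* Let $n\ge 2$ and let $G$ be a proper subdomain of $\mathbb{R}^n$. Then for all $x,y\in G$ $$p_G(x,y)\le \frac{1}{\sqrt{2}}\,j_G(x,y)$$ and $$s_G(x,y)\le \frac{1}{\log 3}\,j_G(x,y),$$ where the constant $\frac{1}{\log 3}$ is the best possible (i.e. no smaller constant works for all proper subdomains $G$ of $\mathbb{R}^n$ and all $x,y\in G$).
   Context: For a domain $G\subsetneq\mathbb{R}^n$ and $x,y\in G$, with $d_G(x)=d(x,\partial G)$ the Euclidean distance from $x$ to $\partial G$: $$s_G(x,y)=\sup_{z\in\partial G}\frac{|x-y|}{|x-z|+|z-y|},\qquad j_G(x,y)=\log\left(1+\frac{|x-y|}{\min\{d_G(x),d_G(y)\}}\right),$$ $$p_G(x,y)=\frac{|x-y|}{\sqrt{|x-y|^2+4\,d_G(x)\,d_G(y)}}.$$ *)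

theory Defs
  imports "HOL-Analysis.Analysis"
begin

definition proper_subdomain :: "'a::euclidean_space set \<Rightarrow> bool" where
  "proper_subdomain G \<longleftrightarrow> open G \<and> connected G \<and> G \<noteq> {} \<and> G \<noteq> UNIV"

text \<open>
  For a proper subdomain the boundary \<open>frontier G\<close> is nonempty, so that
  neither \<open>infdist\<close> below nor the supremum in \<open>s_met\<close> falls back on its value
  for the empty set; the supremum is over a set bounded above by 1.
\<close>

definition bdist :: "'a::euclidean_space set \<Rightarrow> 'a \<Rightarrow> real" where
  "bdist G x = infdist x (frontier G)"

definition s_met :: "'a::euclidean_space set \<Rightarrow> 'a \<Rightarrow> 'a \<Rightarrow> real" where
  "s_met G x y = (SUP z\<in>frontier G. dist x y / (dist x z + dist z y))"

definition j_met :: "'a::euclidean_space set \<Rightarrow> 'a \<Rightarrow> 'a \<Rightarrow> real" where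
  "j_met G x y = ln (1 + dist x y / min (bdist G x) (bdist G y))"

definition p_met :: "'a::euclidean_space set \<Rightarrow> 'a \<Rightarrow> 'a \<Rightarrow> real" where
  "p_met G x y = dist x y / sqrt ((dist x y)\<^sup>2 + 4 * bdist G x * bdist G y)"

end

theory Submission
  imports Defs
begin

text \<open>
  Both inequalities reduce to inequalities in the single variable \<open>u = t / m\<close>, where
  \<open>t = |x - y|\<close> and \<open>m\<close> is the smaller of the distances of \<open>x\<close> and \<open>y\<close> to the boundary;
  in this notation \<open>j = ln (1 + u)\<close>.

  Since the product of the two boundary distances is at least \<open>m\<^sup>2\<close>, one has
  \<open>p \<le> u / sqrt (u\<^sup>2 + 4)\<close>.  The bound \<open>2 u / (2 + u) \<le> ln (1 + u)\<close>, the [1/1]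
  Pade approximant of the logarithm, leaves \<open>(2 + u)\<^sup>2 \<le> 2 (u\<^sup>2 + 4)\<close>, which
  is \<open>(u - 2)\<^sup>2 \<ge> 0\<close>.

  For a boundary point \<open>z\<close> the sum \<open>|x - z| + |z - y|\<close> is at least \<open>2 m\<close>, and at least \<open>t\<close> by the
  triangle inequality, so \<open>s \<le> min 1 (u / 2)\<close>.  The concave function \<open>ln (1 + u)\<close>
  lies above its chord of slope \<open>ln 3 / 2\<close> on \<open>[0, 2]\<close> and above \<open>ln 3\<close> beyond.

  For distinct points, equality in the second estimate forces \<open>u = 2\<close> and a boundary point halfway between \<open>x\<close> and \<open>y\<close>.
  This happens in the space punctured at the origin for \<open>x = e\<close>, \<open>y = - e\<close> with \<open>e\<close> a unit vector; that set is
  connected precisely because the dimension is at least 2.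
\<close>

text \<open>
  The two sides agree at \<open>0\<close>, and their difference has the nonnegative derivative
  \<open>x\<^sup>2 / ((1 + x) (2 + x)\<^sup>2)\<close>.
\<close>

lemma ln_one_plus_ge_Pade:
  fixes u :: real
  assumes "u \<ge> 0"
  shows "2 * u / (2 + u) \<le> ln (1 + u)"
proof -
  have "(\<lambda>u. ln (1 + u) - 2 * u / (2 + u)) 0 \<le> (\<lambda>u. ln (1 + u) - 2 * u / (2 + u)) u"
  proof (rule DERIV_nonneg_imp_nondecreasing[OF assms])
    fix x :: real
    assume x: "0 \<le> x" "x \<le> u"
    have "((\<lambda>u. ln (1 + u) - 2 * u / (2 + u)) has_real_derivative
            1 / (1 + x) - 4 / (2 + x)\<^sup>2) (at x)"
      using x by (auto intro!: derivative_eq_intros simp: power2_eq_square algebra_simps)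
    moreover have "4 / (2 + x)\<^sup>2 \<le> 1 / (1 + x)"
      using x by (simp add: divide_simps add_pos_nonneg power2_eq_square algebra_simps)
    ultimately show "\<exists>y. ((\<lambda>u. ln (1 + u) - 2 * u / (2 + u)) has_real_derivative y) (at x) \<and> 0 \<le> y"
      by fastforce
  qed
  then show ?thesis by simp
qed

text \<open>
  The rational minorant of the logarithm suffices here because the constant \<open>1 / sqrt 2\<close> leaves room:
  the algebraic inequality that remains is an equality at \<open>u = 2\<close>, but there the
  minorant is strictly below the logarithm.
\<close>

lemma ratio_sqrt_le_ln:
  fixes u :: real
  assumes "u \<ge> 0"
  shows "u / sqrt (u\<^sup>2 + 4) \<le> 1 / sqrt 2 * ln (1 + u)"
proof -
  have "2 + u \<le> sqrt 2 * sqrt (u\<^sup>2 + 4)"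
    unfolding real_sqrt_mult[symmetric]
  proof (rule real_le_rsqrt)
    show "(2 + u)\<^sup>2 \<le> 2 * (u\<^sup>2 + 4)"
      using zero_le_power2[of "u - 2"] by (simp add: power2_eq_square algebra_simps)
  qed
  then have "u / sqrt (u\<^sup>2 + 4) \<le> sqrt 2 * u / (2 + u)"
    using assms mult_left_mono[of "2 + u" "sqrt 2 * sqrt (u\<^sup>2 + 4)" u]
    by (simp add: divide_simps add_pos_nonneg algebra_simps)
  also have "\<dots> = 1 / sqrt 2 * (2 * u / (2 + u))"
    using real_div_sqrt[of 2] by (simp add: mult.assoc[symmetric] flip: times_divide_eq_right)
  also have "\<dots> \<le> 1 / sqrt 2 * ln (1 + u)"
    by (intro mult_left_mono ln_one_plus_ge_Pade assms) simp
  finally show ?thesis .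
qed

lemma min_one_half_le_ln:
  fixes u :: real
  assumes "u \<ge> 0"
  shows "min 1 (u / 2) \<le> 1 / ln 3 * ln (1 + u)"
proof (cases "u \<le> 2")
  case True
  \<comment> \<open>\<open>1 + u\<close> is the convex combination of \<open>1\<close> and \<open>3\<close> with weight \<open>u / 2\<close> on \<open>3\<close>, and \<open>ln 1 = 0\<close>.\<close>
  have "concave_on {0<..} (ln :: real \<Rightarrow> real)"
    by (rule ln_concave)
  from concave_onD[OF this, of "u / 2" 1 3] have "u / 2 * ln 3 \<le> ln (1 + u)"
    using assms True by (simp add: algebra_simps)
  then show ?thesis
    by (simp add: field_simps min_le_iff_disj)
next
  case False
  then have "ln 3 \<le> ln (1 + u)"
    by simp
  then show ?thesis
    by (simp add: field_simps min_le_iff_disj)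
qed

lemma frontier_proper_subdomain_nonempty:
  assumes "proper_subdomain G"
  shows "frontier G \<noteq> {}"
  using assms by (simp add: proper_subdomain_def frontier_eq_empty)

lemma bdist_pos:
  assumes "proper_subdomain G" "x \<in> G"
  shows "bdist G x > 0"
proof -
  have "x \<notin> frontier G"
    using assms by (auto simp: proper_subdomain_def frontier_def interior_open)
  then show ?thesis
    unfolding bdist_def
    using frontier_proper_subdomain_nonempty[OF assms(1)]
    by (intro infdist_pos_not_in_closed) auto
qed

lemma p_met_le_j_met:
  assumes "proper_subdomain G" "x \<in> G" "y \<in> G"
  shows "p_met G x y \<le> 1 / sqrt 2 * j_met G x y"
proof -
  define m where "m = min (bdist G x) (bdist G y)"
  define u where "u = dist x y / m"
  have m: "m > 0"
    using assms by (simp add: m_def bdist_pos)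
  then have u: "u \<ge> 0"
    by (simp add: u_def)
  have t: "dist x y = u * m"
    using m by (simp add: u_def)
  have "m * m \<le> bdist G x * bdist G y"
    using m by (intro mult_mono) (auto simp: m_def)
  then have "p_met G x y \<le> u * m / sqrt ((u * m)\<^sup>2 + 4 * (m * m))"
    unfolding p_met_def t using m u
    by (intro divide_left_mono real_sqrt_le_mono mult_pos_pos)
       (auto intro!: add_nonneg_pos add_nonneg_nonneg mult_pos_pos bdist_pos assms simp: mult.assoc)
  also have "(u * m)\<^sup>2 + 4 * (m * m) = (u\<^sup>2 + 4) * m\<^sup>2"
    by (simp add: power2_eq_square algebra_simps)
  also have "u * m / sqrt ((u\<^sup>2 + 4) * m\<^sup>2) = u / sqrt (u\<^sup>2 + 4)"
    using m by (simp add: real_sqrt_mult)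
  also have "\<dots> \<le> 1 / sqrt 2 * ln (1 + u)"
    by (rule ratio_sqrt_le_ln[OF u])
  finally show ?thesis
    by (simp add: j_met_def u_def m_def)
qed

lemma s_met_le_j_met:
  assumes "proper_subdomain G" "x \<in> G" "y \<in> G"
  shows "s_met G x y \<le> 1 / ln 3 * j_met G x y"
proof -
  define m where "m = min (bdist G x) (bdist G y)"
  define u where "u = dist x y / m"
  have m: "m > 0"
    using assms by (simp add: m_def bdist_pos)
  then have u: "u \<ge> 0"
    by (simp add: u_def)
  have "s_met G x y \<le> min 1 (u / 2)"
    unfolding s_met_def
  proof (rule cSUP_least)
    show "frontier G \<noteq> {}"
      by (rule frontier_proper_subdomain_nonempty[OF assms(1)])
  next
    fix z assume z: "z \<in> frontier G"
    have "bdist G x \<le> dist x z" "bdist G y \<le> dist z y"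
      using infdist_le[OF z, of x] infdist_le[OF z, of y]
      by (simp_all add: bdist_def dist_commute)
    then have "2 * m \<le> dist x z + dist z y"
      by (simp add: m_def)
    then have "dist x y / (dist x z + dist z y) \<le> dist x y / (2 * m)"
      using m by (intro divide_left_mono mult_pos_pos) auto
    moreover have "dist x y / (dist x z + dist z y) \<le> 1"
      by (intro divide_le_eq_1_pos[THEN iffD2] dist_triangle)
         (use \<open>2 * m \<le> dist x z + dist z y\<close> m in linarith)
    ultimately show "dist x y / (dist x z + dist z y) \<le> min 1 (u / 2)"
      by (simp add: u_def mult.commute)
  qed
  also have "\<dots> \<le> 1 / ln 3 * ln (1 + u)"
    by (rule min_one_half_le_ln[OF u])
  finally show ?thesis
    by (simp add: j_met_def u_def m_def)
qed

lemma frontier_singleton: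
  fixes a :: "'a::euclidean_space"
  shows "frontier {a} = {a}"
  by (simp add: frontier_def)

lemma proper_subdomain_punctured_space:
  fixes a :: "'a::euclidean_space"
  assumes "DIM('a) \<ge> 2"
  shows "proper_subdomain (- {a})"
proof -
  have "connected (- {a})"
    using assms by (rule connected_punctured_universe)
  moreover have "- {a} \<noteq> {}"
    using UNIV_not_singleton[of a] by auto
  ultimately show ?thesis
    by (auto simp: proper_subdomain_def)
qed

text \<open>
  The origin is the only boundary point and lies on the segment from \<open>e\<close> to \<open>- e\<close>, so the
  quotient there attains its maximal value 1; both points have boundary distance 1
  and mutual distance 2, hence \<open>u = 2\<close>.
\<close>

lemma s_met_punctured_space_antipodal:
  fixes e :: "'a::euclidean_space"
  assumes "norm e = 1"
  shows "s_met (- {0}) e (- e) = 1"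
  using assms by (simp add: s_met_def frontier_singleton dist_norm
      flip: scaleR_2)

lemma j_met_punctured_space_antipodal:
  fixes e :: "'a::euclidean_space"
  assumes "norm e = 1"
  shows "j_met (- {0}) e (- e) = ln 3"
  using assms by (simp add: j_met_def bdist_def frontier_singleton dist_norm
      flip: scaleR_2)

theorem theorem1p7:
  assumes "CARD('n::finite) \<ge> 2"
  shows "(\<forall>G :: (real ^ 'n) set. proper_subdomain G \<longrightarrow>
            (\<forall>x\<in>G. \<forall>y\<in>G.
               p_met G x y \<le> 1 / sqrt 2 * j_met G x y \<and>
               s_met G x y \<le> 1 / ln 3 * j_met G x y)) \<and>
         (\<forall>c < 1 / ln 3. \<exists>G :: (real ^ 'n) set. proper_subdomain G \<and>
            (\<exists>x\<in>G. \<exists>y\<in>G. \<not> s_met G x y \<le> c * j_met G x y))"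
proof (intro conjI allI impI ballI)
  fix G :: "(real ^ 'n) set" and x y
  assume G: "proper_subdomain G" "x \<in> G" "y \<in> G"
  show "p_met G x y \<le> 1 / sqrt 2 * j_met G x y"
    using G by (rule p_met_le_j_met)
  show "s_met G x y \<le> 1 / ln 3 * j_met G x y"
    using G by (rule s_met_le_j_met)
next
  fix c :: real
  assume c: "c < 1 / ln 3"
  obtain e :: "real ^ 'n" where e: "norm e = 1"
    using vector_choose_size[of 1] by auto
  have "proper_subdomain (- {0 :: real ^ 'n})"
    using assms by (intro proper_subdomain_punctured_space) simp
  moreover have "e \<in> - {0}" "- e \<in> - {0}"
    using e by auto
  moreover have "\<not> s_met (- {0}) e (- e) \<le> c * j_met (- {0}) e (- e)"
    using c by (simp add: s_met_punctured_space_antipodal[OF e]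
        j_met_punctured_space_antipodal[OF e] field_simps)
  ultimately show "\<exists>G :: (real ^ 'n) set. proper_subdomain G \<and>
      (\<exists>x\<in>G. \<exists>y\<in>G. \<not> s_met G x y \<le> c * j_met G x y)"
    by blast
qed

end
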